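(* Let $(G,\tau)$ be an $ss$-characterized precompact abelian group which is also a $k$-space. Then $G$ is countable and sequential.
   Context: All topological groups are Hausdorff and abelian. "Countable" means finite or countably infinite. A group topology on $G$ is precompact if it is Hausdorff and for every neighborhood $U$ of $0$ there is a finite $F\subseteq G$ with $F+U=G$. A sequence $\mathbf{u}=(u_n)$ in an abelian group $G$ is a $TB$-sequence if there is a precompact group topology on $G$ in which $u_n\to0$; then $\tau_{\mathbf{u}}$ denotes the finest precompact group topology on $G$ in which $u_n\to 0$. A precompact group $(G,\tau)$ is $ss$-characterized if there is a $TB$-sequence $\mathbf{u}$ in $G$ with $\tau=\tau_{\mathbf{u}}$. A Hausdorff space $X$ is a $k$-space if a subset $A\subseteq X$ is closed whenever $A\cap K$ is closed in $K$ for every compact $K\subseteq X$; $X$ is sequential if every sequentially closed subset of $X$ is closed. *)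

theory Defs
  imports "HOL-Analysis.Analysis"
begin

text \<open>
  The abelian group is an entire type of class \<open>ab_group_add\<close>. Since several topologies on the
  same group are compared, topologies are values of type \<open>'a topology\<close> with full carrier.
\<close>

definition group_topology :: "'a::ab_group_add topology \<Rightarrow> bool" where
  "group_topology T \<longleftrightarrow>
     topspace T = UNIV \<and>
     continuous_map (prod_topology T T) T (\<lambda>(x, y). x + y) \<and>
     continuous_map T T uminus"

definition precompact_group_topology :: "'a::ab_group_add topology \<Rightarrow> bool" where
  "precompact_group_topology T \<longleftrightarrow>
     group_topology T \<and> Hausdorff_space T \<and>
     (\<forall>U V. openin T V \<and> 0 \<in> V \<and> V \<subseteq> U \<longrightarrow>
        (\<exists>F. finite F \<and> {f + x | f x. f \<in> F \<and> x \<in> U} = UNIV))"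

definition TB_sequence :: "(nat \<Rightarrow> 'a::ab_group_add) \<Rightarrow> bool" where
  "TB_sequence u \<longleftrightarrow>
     (\<exists>T. precompact_group_topology T \<and> limitin T u 0 sequentially)"

text \<open>
  \<open>is_tau u T\<close> says that \<open>T\<close> is the topology \<open>\<tau>\<^sub>u\<close>, i.e. the greatest element, with respect to
  inclusion of the families of open sets, among the precompact group topologies in which \<open>u\<close>
  converges to 0.
\<close>

definition is_tau :: "(nat \<Rightarrow> 'a::ab_group_add) \<Rightarrow> 'a topology \<Rightarrow> bool" where
  "is_tau u T \<longleftrightarrow>
     precompact_group_topology T \<and> limitin T u 0 sequentially \<and>
     (\<forall>S. precompact_group_topology S \<and> limitin S u 0 sequentially \<longrightarrow>
        (\<forall>U. openin S U \<longrightarrow> openin T U))"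

lemma is_tau_unique:
  assumes "is_tau u S" "is_tau u T"
  shows "S = T"
  using assms unfolding is_tau_def topology_eq by blast

definition ss_characterized :: "'a::ab_group_add topology \<Rightarrow> bool" where
  "ss_characterized T \<longleftrightarrow>
     precompact_group_topology T \<and> (\<exists>u. TB_sequence u \<and> is_tau u T)"

definition sequentially_closedin :: "'a topology \<Rightarrow> 'a set \<Rightarrow> bool" where
  "sequentially_closedin X A \<longleftrightarrow>
     A \<subseteq> topspace X \<and>
     (\<forall>\<sigma> l. range \<sigma> \<subseteq> A \<and> limitin X \<sigma> l sequentially \<longrightarrow> l \<in> A)"

definition sequential_space :: "'a topology \<Rightarrow> bool" where
  "sequential_space X \<longleftrightarrow> (\<forall>A. sequentially_closedin X A \<longrightarrow> closedin X A)"

end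

theory Submission
  imports Defs "HOL-Computational_Algebra.Group_Closure"
begin

text \<open>
  Let \<open>u\<close> be a sequence with \<open>T = \<tau>\<^sub>u\<close>, let \<open>N\<close> be the countable subgroup that \<open>u\<close> generates,
  and let \<open>N\<^sup>\<bottom>\<close> be the group of all characters of \<open>G\<close> (homomorphisms into the unit circle, with
  no continuity required) that are trivial on \<open>N\<close>.

  Refining \<open>T\<close> by one further character \<open>\<phi> \<in> N\<^sup>\<bottom>\<close> gives another precompact group topology in
  which \<open>u\<close> tends to 0. By maximality of \<open>\<tau>\<^sub>u\<close>, every \<open>\<phi> \<in> N\<^sup>\<bottom>\<close> is \<open>T\<close>-continuous
  (\<open>is_tau_character_continuous\<close>). The circle is divisible, so \<open>N\<^sup>\<bottom>\<close> separates the cosets of \<open>N\<close>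
  (\<open>annihilator_separates\<close>), and all cosets of \<open>N\<close>, or of any larger subgroup, are \<open>T\<close>-closed.
  In effect \<open>G / N\<close> carries a topology at least as fine as its Bohr topology, and in the Bohr
  topology of a discrete abelian group every compact set is finite.

  This last fact appears here as the statement that a \<open>T\<close>-compact set meets only finitely many
  cosets of \<open>N\<close> (\<open>is_tau_compact_finite_cosets\<close>). It has two ingredients. A convergent sequence
  ends up in the coset of its limit: by the Baire category theorem on the compact group \<open>N\<^sup>\<bottom>\<close>,
  pointwise convergence of the sequence on \<open>N\<^sup>\<bottom>\<close> is uniform up to a fixed error, and a character
  value all of whose powers stay near 1 equals 1 (\<open>annihilator_null_sequence_eventually_in\<close>).
  Moreover, convergent sequences suffice: infinitely many cosets met by a compact set can be
  found inside a countable closed subgroup, and in a countable compact Hausdorff space closures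
  are obtained by sequences (\<open>countable_compact_closure_imp_limit\<close>).

  Hence the complement of \<open>N\<close> has closed trace on every compact set. In a k-space it is
  therefore closed, so \<open>N\<close> is open, of finite index by precompactness, and \<open>G\<close> is countable
  along with \<open>N\<close>. Once \<open>G\<close> is countable its compact subsets are countable, so their topology is
  determined by sequences, and the k-space property turns into sequentiality.
\<close>

section \<open>Subgroups, generated subgroups and integer multiples\<close>

definition add_subgroup :: "'a::ab_group_add set \<Rightarrow> bool" where
  "add_subgroup H \<longleftrightarrow> 0 \<in> H \<and> (\<forall>x\<in>H. \<forall>y\<in>H. x - y \<in> H)"

lemma add_subgroup_zero: "add_subgroup H \<Longrightarrow> 0 \<in> H"
  by (simp add: add_subgroup_def)

lemma add_subgroup_diff: "add_subgroup H \<Longrightarrow> x \<in> H \<Longrightarrow> y \<in> H \<Longrightarrow> x - y \<in> H"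
  by (simp add: add_subgroup_def)

lemma add_subgroup_minus: "add_subgroup H \<Longrightarrow> x \<in> H \<Longrightarrow> - x \<in> H"
  using add_subgroup_diff[of H 0 x] add_subgroup_zero[of H] by simp

lemma add_subgroup_add: "add_subgroup H \<Longrightarrow> x \<in> H \<Longrightarrow> y \<in> H \<Longrightarrow> x + y \<in> H"
  using add_subgroup_diff[of H x "- y"] add_subgroup_minus[of H y] by simp

lemma add_subgroup_group_closure: "add_subgroup (group_closure S)"
  by (simp add: add_subgroup_def group_closure.diff)

text \<open>Every element of the generated subgroup is the sum of a finite list of generators and their
  negatives.\<close>
lemma countable_group_closure:
  assumes "countable (S :: 'a::ab_group_add set)"
  shows "countable (group_closure S)"
proof -
  have "group_closure S \<subseteq> sum_list ` lists (S \<union> uminus ` S)"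
  proof
    fix x assume "x \<in> group_closure S"
    then show "x \<in> sum_list ` lists (S \<union> uminus ` S)"
    proof induction
      case (base s)
      show ?case
      proof (cases "s \<in> S")
        case True
        then show ?thesis by (intro image_eqI[of _ _ "[s]"]) auto
      next
        case False
        then show ?thesis using base by (intro image_eqI[of _ _ "[]"]) auto
      qed
    next
      case (diff s t)
      then obtain xs ys where xs: "xs \<in> lists (S \<union> uminus ` S)" "s = sum_list xs"
        and ys: "ys \<in> lists (S \<union> uminus ` S)" "t = sum_list ys" by blast
      have "sum_list (map uminus ys) = - sum_list ys"
        by (induction ys) auto
      moreover have "map uminus ys \<in> lists (S \<union> uminus ` S)"
        using ys(1) by (auto simp: in_lists_conv_set)
      ultimately show ?case
        using xs ys by (intro image_eqI[of _ _ "xs @ map uminus ys"]) auto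
    qed
  qed
  then show ?thesis
    by (rule countable_subset) (simp add: assms)
qed

text \<open>Integer multiples in an arbitrary abelian group; they are needed to adjoin one element to a
  subgroup.\<close>
primrec nat_mult :: "nat \<Rightarrow> 'a::ab_group_add \<Rightarrow> 'a" where
  "nat_mult 0 x = 0"
| "nat_mult (Suc n) x = nat_mult n x + x"

definition int_mult :: "int \<Rightarrow> 'a::ab_group_add \<Rightarrow> 'a" where
  "int_mult k x = nat_mult (nat k) x - nat_mult (nat (- k)) x"

lemma int_mult_0 [simp]: "int_mult 0 x = 0"
  by (simp add: int_mult_def)

lemma int_mult_plus1: "int_mult (k + 1) x = int_mult k x + x"
proof (cases "k \<ge> 0")
  case True
  then have "nat (k + 1) = Suc (nat k)" "nat (- k) = 0" "nat (- (k + 1)) = 0" by auto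
  then show ?thesis unfolding int_mult_def by simp
next
  case False
  then have "nat (- k) = Suc (nat (- (k + 1)))" "nat k = 0" "nat (k + 1) = 0" by auto
  then show ?thesis unfolding int_mult_def by simp
qed

lemma int_mult_minus1: "int_mult (k - 1) x = int_mult k x - x"
  using int_mult_plus1[of "k - 1" x] by simp

lemma int_mult_1 [simp]: "int_mult 1 x = x"
  using int_mult_plus1[of 0 x] by simp

lemma int_mult_add: "int_mult (j + k) x = int_mult j x + int_mult k x"
proof (induction k rule: int_induct[of _ 0])
  case (step1 i)
  then show ?case using int_mult_plus1[of "j + i" x] int_mult_plus1[of i x]
    by (simp add: add.assoc)
next
  case (step2 i)
  then show ?case using int_mult_minus1[of "j + i" x] int_mult_minus1[of i x]
    by (simp add: add_diff_eq)
qed simp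

lemma int_mult_minus: "int_mult (- k) x = - int_mult k x"
  using int_mult_add[of "- k" k x] by (simp add: eq_neg_iff_add_eq_0)

lemma int_mult_diff: "int_mult (j - k) x = int_mult j x - int_mult k x"
  using int_mult_add[of j "- k" x] by (simp add: int_mult_minus)

lemma int_mult_mult: "int_mult (j * k) x = int_mult j (int_mult k x)"
proof (induction j rule: int_induct[of _ 0])
  case (step1 i)
  then show ?case by (simp add: distrib_right int_mult_add)
next
  case (step2 i)
  then show ?case by (simp add: left_diff_distrib int_mult_diff)
qed simp

lemma add_subgroup_int_mult:
  assumes R: "add_subgroup (R :: ('a::ab_group_add \<times> real) set)" and xs: "(x, s) \<in> R"
  shows "(int_mult k x, of_int k * s) \<in> R"
proof (induction k rule: int_induct[of _ 0])
  case base
  then show ?case using add_subgroup_zero[OF R] by (simp add: zero_prod_def)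
next
  case (step1 i)
  then show ?case using add_subgroup_add[OF R step1(2) xs]
    by (simp add: int_mult_add distrib_right)
next
  case (step2 i)
  then show ?case using add_subgroup_diff[OF R step2(2) xs]
    by (simp add: int_mult_diff left_diff_distrib)
qed

section \<open>Extension of characters from subgroups\<close>

text \<open>A homomorphism from a subgroup of \<open>'a\<close> to \<open>\<real> / \<int>\<close>, encoded by the preimage of its graph in \<open>'a
  \<times> \<real>\<close>. Working with real phases instead of complex numbers turns the extraction of roots, which
  is what makes the circle divisible, into division.\<close>
definition partial_character :: "('a::ab_group_add \<times> real) set \<Rightarrow> bool" where
  "partial_character R \<longleftrightarrow> add_subgroup R \<and> (\<forall>t. (0, t) \<in> R \<longleftrightarrow> t \<in> \<int>)"

text \<open>The phase \<open>t\<close> that an extension assigns to \<open>x\<close> must satisfy \<open>m t = \<phi> (m x)\<close> modulo \<open>\<int>\<close>, where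
  \<open>m\<close> is the order of \<open>x\<close> modulo the domain. There are \<open>m\<close> solutions modulo \<open>\<int>\<close>, and since \<open>m \<ge>
  2\<close> one of them is not an integer; if no positive multiple of \<open>x\<close> lies in the domain then \<open>t\<close>
  is arbitrary. That \<open>t\<close> can be chosen outside \<open>\<int>\<close> is what later separates \<open>x\<close> from a subgroup.\<close>
lemma compatible_phase:
  fixes R :: "('a::ab_group_add \<times> real) set"
  assumes R: "partial_character R" and x: "x \<notin> fst ` R"
  obtains t where "t \<notin> \<int>" "\<And>k s. (int_mult k x, s) \<in> R \<Longrightarrow> s - of_int k * t \<in> \<int>"
proof -
  have sg: "add_subgroup R" and int: "\<And>t. (0, t) \<in> R \<longleftrightarrow> t \<in> \<int>"
    using R by (auto simp: partial_character_def)
  show thesis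
  proof (cases "\<exists>n::nat. n > 0 \<and> int_mult (int n) x \<in> fst ` R")
    case False
    have "s - of_int k * (1/2) \<in> \<int>" if ks: "(int_mult k x, s) \<in> R" for k s
    proof -
      have "(int_mult (- k) x, - s) \<in> R"
        using add_subgroup_minus[OF sg ks] by (simp add: int_mult_minus)
      then have "int_mult k x \<in> fst ` R" "int_mult (- k) x \<in> fst ` R"
        using ks by force+
      then have "k = 0"
        using False[simplified, rule_format, of "nat k"] False[simplified, rule_format, of "nat (- k)"]
        by (cases "k > 0"; cases "k < 0") auto
      then show ?thesis using ks int by simp
    qed
    moreover have "(1/2 :: real) \<notin> \<int>"
    proof
      assume "(1/2 :: real) \<in> \<int>"
      then obtain z :: int where "1/2 = (of_int z :: real)" by (auto elim: Ints_cases)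
      then have "(of_int (2 * z) :: real) = of_int 1" by simp
      then have "2 * z = 1" by (simp only: of_int_eq_iff)
      then show False by presburger
    qed
    ultimately show thesis using that by blast
  next
    case True
    define m where "m = (LEAST n::nat. n > 0 \<and> int_mult (int n) x \<in> fst ` R)"
    have m: "m > 0" "int_mult (int m) x \<in> fst ` R"
      using LeastI_ex[OF True] by (auto simp: m_def)
    have m_least: "int_mult (int n) x \<notin> fst ` R" if "0 < n" "n < m" for n
      using not_less_Least[of n "\<lambda>n. n > 0 \<and> int_mult (int n) x \<in> fst ` R"] that
      by (auto simp: m_def)
    have "m \<noteq> 1" using m(2) x by (metis int_mult_1 of_nat_1)
    with m have m2: "m \<ge> 2" by simp
    obtain s0 where s0: "(int_mult (int m) x, s0) \<in> R" using m by force
    \<comment> \<open>The candidates \<open>s0 / m\<close> and \<open>(s0 + 1) / m\<close> differ by \<open>1 / m\<close>, so one is not an integer.\<close>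
    obtain t where t: "t \<notin> \<int>" "of_nat m * t - s0 \<in> \<int>"
    proof (cases "s0 / m \<in> \<int>")
      case False
      show thesis by (rule that[OF False]) (use m in simp)
    next
      case True
      have "(s0 + 1) / m \<notin> \<int>"
      proof
        assume "(s0 + 1) / m \<in> \<int>"
        then have "(s0 + 1) / m - s0 / m \<in> \<int>" using True by (rule Ints_diff)
        then have "1 / real m \<in> \<int>" by (simp add: diff_divide_distrib[symmetric])
        then obtain z where z: "1 / real m = of_int z" by (auto elim: Ints_cases)
        have "0 < 1 / real m" "1 / real m < 1" using m2 by auto
        then show False unfolding z by auto
      qed
      then show thesis by (rule that) (use m in simp)
    qed
    have "s - of_int k * t \<in> \<int>" if ks: "(int_mult k x, s) \<in> R" for k s
    proof -
      define q r where "q = k div int m" and "r = k mod int m"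
      have k: "k = q * int m + r" by (simp add: q_def r_def)
      have mult: "(int_mult (q * int m) x, of_int q * s0) \<in> R"
        using add_subgroup_int_mult[OF sg s0, of q] by (simp add: int_mult_mult)
      have d: "(int_mult r x, s - of_int q * s0) \<in> R"
        using add_subgroup_diff[OF sg ks mult] by (simp add: k int_mult_add)
      then have "int_mult (int (nat r)) x \<in> fst ` R"
        using m by (force simp: r_def)
      then have "nat r = 0"
        using m_least[of "nat r"] m by (force simp: r_def nat_less_iff)
      moreover have "r \<ge> 0" using m by (simp add: r_def)
      ultimately have r: "r = 0" by simp
      then have "s - of_int q * s0 \<in> \<int>" using d int by simp
      moreover have "of_int q * (of_nat m * t - s0) \<in> \<int>" using t by simp
      ultimately have "(s - of_int q * s0) - of_int q * (of_nat m * t - s0) \<in> \<int>" by (rule Ints_diff)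
      then show ?thesis by (simp add: k r algebra_simps)
    qed
    then show thesis using that t by blast
  qed
qed

lemma partial_character_extend:
  fixes R :: "('a::ab_group_add \<times> real) set"
  assumes R: "partial_character R" and x: "x \<notin> fst ` R"
  obtains R' t where "partial_character R'" "R \<subseteq> R'" "(x, t) \<in> R'" "t \<notin> \<int>"
proof -
  have sg: "add_subgroup R" and int: "\<And>t. (0, t) \<in> R \<longleftrightarrow> t \<in> \<int>"
    using R by (auto simp: partial_character_def)
  obtain t where t: "t \<notin> \<int>" "\<And>k s. (int_mult k x, s) \<in> R \<Longrightarrow> s - of_int k * t \<in> \<int>"
    using compatible_phase[OF R x] by blast
  define R' where "R' = {(a + int_mult k x, s + of_int k * t) | a s k. (a, s) \<in> R}"
  have sub: "R \<subseteq> R'"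
  proof
    fix p assume "p \<in> R"
    then show "p \<in> R'" unfolding R'_def
      by (cases p) (force intro: exI[of _ "0::int"])
  qed
  have zero: "(0, 0) \<in> R" using int by simp
  have xt: "(x, t) \<in> R'"
    unfolding R'_def using zero by (force intro: exI[of _ "1::int"])
  have "add_subgroup R'"
    unfolding add_subgroup_def
  proof (intro conjI ballI)
    show "0 \<in> R'" using zero sub by (auto simp: zero_prod_def)
    fix p q assume "p \<in> R'" "q \<in> R'"
    then obtain a s k b r j where
      p: "p = (a + int_mult k x, s + of_int k * t)" "(a, s) \<in> R"
      and q: "q = (b + int_mult j x, r + of_int j * t)" "(b, r) \<in> R"
      unfolding R'_def by blast
    have "p - q = ((a - b) + int_mult (k - j) x, (s - r) + of_int (k - j) * t)"
      unfolding p q by (simp add: int_mult_diff algebra_simps)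
    moreover have "(a - b, s - r) \<in> R"
      using add_subgroup_diff[OF sg p(2) q(2)] by simp
    ultimately show "p - q \<in> R'" unfolding R'_def by blast
  qed
  moreover have "(0, w) \<in> R' \<longleftrightarrow> w \<in> \<int>" for w
  proof
    assume "(0, w) \<in> R'"
    then obtain a s k where w: "0 = a + int_mult k x" "w = s + of_int k * t" "(a, s) \<in> R"
      unfolding R'_def by blast
    then have "a = int_mult (- k) x" by (simp add: int_mult_minus eq_neg_iff_add_eq_0)
    then show "w \<in> \<int>" using t(2)[of "- k" s] w by simp
  next
    assume "w \<in> \<int>" then show "(0, w) \<in> R'" using int sub by blast
  qed
  ultimately have "partial_character R'" by (simp add: partial_character_def)
  then show thesis using that sub xt t by blast
qed

text \<open>By Zorn's lemma there is a maximal extension, and a maximal one is total because it could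
  otherwise be extended by one more element.\<close>
lemma partial_character_total_extension:
  fixes R :: "('a::ab_group_add \<times> real) set"
  assumes "partial_character R"
  obtains M where "partial_character M" "R \<subseteq> M" "fst ` M = UNIV"
proof -
  let ?\<A> = "{M. partial_character M \<and> R \<subseteq> M}"
  have "\<exists>M\<in>?\<A>. \<forall>X\<in>?\<A>. M \<subseteq> X \<longrightarrow> X = M"
  proof (rule subset_Zorn_nonempty)
    show "?\<A> \<noteq> {}" using assms by blast
    fix C assume C: "C \<noteq> {}" "subset.chain ?\<A> C"
    have mem: "add_subgroup M \<and> (\<forall>t. (0, t) \<in> M \<longleftrightarrow> t \<in> \<int>) \<and> R \<subseteq> M" if "M \<in> C" for M
      using C that by (auto simp: subset.chain_def partial_character_def)
    have "add_subgroup (\<Union>C)"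
      unfolding add_subgroup_def
    proof (intro conjI ballI)
      show "0 \<in> \<Union>C" using C(1) mem by (auto simp: add_subgroup_def)
      fix p q assume "p \<in> \<Union>C" "q \<in> \<Union>C"
      then obtain M M' where M: "M \<in> C" "p \<in> M" "M' \<in> C" "q \<in> M'" by blast
      then have "M \<subseteq> M' \<or> M' \<subseteq> M" using C(2) by (auto simp: subset_chain_def)
      then obtain L where "L \<in> C" "p \<in> L" "q \<in> L" using M by blast
      then show "p - q \<in> \<Union>C" using mem[of L] by (auto simp: add_subgroup_def)
    qed
    then show "\<Union>C \<in> ?\<A>" using C(1) mem by (auto simp: partial_character_def)
  qed
  then obtain M where M': "M \<in> ?\<A>" and M_max: "\<forall>X\<in>?\<A>. M \<subseteq> X \<longrightarrow> X = M"
    by (rule bexE)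
  from M' have M: "partial_character M" "R \<subseteq> M" by auto
  have "x \<in> fst ` M" for x
  proof (rule ccontr)
    assume x: "x \<notin> fst ` M"
    obtain M' t where M': "partial_character M'" "M \<subseteq> M'" "(x, t) \<in> M'"
      using partial_character_extend[OF M(1) x] by blast
    then have "M' \<in> ?\<A>" using M(2) by simp
    then have "M' = M" using M_max M'(2) by blast
    then show False using M'(3) x by force
  qed
  then show thesis using that M by blast
qed

definition character :: "('a::ab_group_add \<Rightarrow> complex) \<Rightarrow> bool" where
  "character \<phi> \<longleftrightarrow> (\<forall>x y. \<phi> (x + y) = \<phi> x * \<phi> y) \<and> (\<forall>x. norm (\<phi> x) = 1)"

lemma character_of_total_partial_character:
  fixes M :: "('a::ab_group_add \<times> real) set"
  assumes M: "partial_character M" "fst ` M = UNIV"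
  obtains \<phi> where "character \<phi>" "\<And>x t. (x, t) \<in> M \<Longrightarrow> \<phi> x = cis (2 * pi * t)"
proof -
  have sg: "add_subgroup M" and int: "\<And>t. (0, t) \<in> M \<longleftrightarrow> t \<in> \<int>"
    using M by (auto simp: partial_character_def)
  define \<phi> where "\<phi> x = cis (2 * pi * (SOME t. (x, t) \<in> M))" for x
  have \<phi>: "\<phi> x = cis (2 * pi * t)" if "(x, t) \<in> M" for x t
  proof -
    let ?s = "SOME t. (x, t) \<in> M"
    have "(x, ?s) \<in> M" using that by (rule someI)
    then have "(0, t - ?s) \<in> M" using add_subgroup_diff[OF sg that, of "(x, ?s)"] by simp
    then have "t - ?s \<in> \<int>" using int by blast
    then obtain z where "t - ?s = of_int z" by (auto elim: Ints_cases)
    then have "2 * pi * t = 2 * pi * ?s + 2 * pi * of_int z" by (simp add: algebra_simps)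
    then have "cis (2 * pi * t) = cis (2 * pi * ?s) * cis (2 * pi * of_int z)"
      by (simp only: cis_mult)
    then have "cis (2 * pi * t) = cis (2 * pi * ?s)"
      by (simp add: cis_multiple_2pi)
    then show ?thesis by (simp add: \<phi>_def)
  qed
  have "\<phi> (x + y) = \<phi> x * \<phi> y" for x y
  proof -
    have "x \<in> fst ` M" "y \<in> fst ` M" using M(2) by auto
    then obtain s t where st: "(x, s) \<in> M" "(y, t) \<in> M" by auto
    then have "(x + y, s + t) \<in> M" using add_subgroup_add[OF sg st] by simp
    then show ?thesis
      using \<phi>[OF st(1)] \<phi>[OF st(2)] \<phi>[of "x + y" "s + t"] by (simp add: cis_mult distrib_left)
  qed
  moreover have "norm (\<phi> x) = 1" for x by (simp add: \<phi>_def)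
  ultimately have "character \<phi>" by (simp add: character_def)
  then show thesis using that \<phi> by blast
qed

definition annihilator :: "'a::ab_group_add set \<Rightarrow> ('a \<Rightarrow> complex) set" where
  "annihilator N = {\<phi>. character \<phi> \<and> (\<forall>x\<in>N. \<phi> x = 1)}"

text \<open>The trivial character of \<open>N\<close> is first extended to \<open>x\<close> with a non-integral phase, and then to
  the whole group.\<close>
lemma annihilator_separates:
  assumes N: "add_subgroup (N :: 'a::ab_group_add set)" and x: "x \<notin> N"
  obtains \<phi> where "\<phi> \<in> annihilator N" "\<phi> x \<noteq> 1"
proof -
  have R: "partial_character (N \<times> (\<int> :: real set))"
    using N by (auto simp: partial_character_def add_subgroup_def zero_prod_def)
  moreover have "x \<notin> fst ` (N \<times> (\<int> :: real set))" using x by auto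
  ultimately obtain R' t where R': "partial_character R'" "N \<times> \<int> \<subseteq> R'" "(x, t) \<in> R'" "t \<notin> \<int>"
    using partial_character_extend by blast
  obtain M where M: "partial_character M" "R' \<subseteq> M" "fst ` M = UNIV"
    using partial_character_total_extension[OF R'(1)] by blast
  obtain \<phi> where \<phi>: "character \<phi>" "\<And>x t. (x, t) \<in> M \<Longrightarrow> \<phi> x = cis (2 * pi * t)"
    using character_of_total_partial_character[OF M(1,3)] by blast
  have "\<phi> n = 1" if "n \<in> N" for n
  proof -
    have "(n, 0) \<in> N \<times> (\<int> :: real set)" using that by simp
    then have "(n, 0) \<in> M" using R' M by blast
    then show ?thesis using \<phi>(2)[of n 0] by simp
  qed
  then have "\<phi> \<in> annihilator N" using \<phi> by (simp add: annihilator_def)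
  moreover have "\<phi> x \<noteq> 1"
  proof
    assume "\<phi> x = 1"
    then have "cis (2 * pi * t) = 1" using \<phi>(2)[of x t] R' M by auto
    then have "cos (2 * pi * t) = 1" by (simp add: complex_eq_iff)
    then obtain n :: int where "2 * pi * t = of_int n * 2 * pi"
      using cos_one_2pi_int[of "2 * pi * t"] by auto
    then have "t = of_int n" by simp
    then show False using R'(4) by simp
  qed
  ultimately show thesis using that by blast
qed

section \<open>Characters and the compact group of characters trivial on a subgroup\<close>

lemma character_add: "character \<phi> \<Longrightarrow> \<phi> (x + y) = \<phi> x * \<phi> y"
  by (simp add: character_def)

lemma norm_character [simp]: "character \<phi> \<Longrightarrow> norm (\<phi> x) = 1"
  by (simp add: character_def)

lemma character_zero:
  assumes "character \<phi>"
  shows "\<phi> 0 = 1"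
proof -
  have "\<phi> 0 * \<phi> 0 = \<phi> 0" using character_add[OF assms, of 0 0] by simp
  moreover have "\<phi> 0 \<noteq> 0" using norm_character[OF assms, of 0] by auto
  ultimately show ?thesis by simp
qed

lemma character_mult_cnj:
  assumes "character \<phi>"
  shows "\<phi> x * cnj (\<phi> x) = 1"
  using norm_character[OF assms, of x] by (simp add: complex_norm_square[symmetric])

lemma character_minus:
  assumes "character \<phi>"
  shows "\<phi> (- x) = cnj (\<phi> x)"
proof -
  have "\<phi> x * \<phi> (- x) = \<phi> x * cnj (\<phi> x)"
    using character_add[OF assms, of x "- x"] character_zero[OF assms] character_mult_cnj[OF assms, of x]
    by simp
  moreover have "\<phi> x \<noteq> 0" using norm_character[OF assms, of x] by auto
  ultimately show ?thesis by simp
qed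

lemma character_diff:
  assumes "character \<phi>"
  shows "\<phi> (x - y) = \<phi> x * cnj (\<phi> y)"
  using character_add[OF assms, of x "- y"] character_minus[OF assms, of y] by simp

lemma dist_character:
  assumes "character \<phi>"
  shows "norm (\<phi> (x - y) - 1) = norm (\<phi> x - \<phi> y)"
proof -
  have "\<phi> x - \<phi> y = (\<phi> (x - y) - 1) * \<phi> y"
    using character_add[OF assms, of "x - y" y] by (simp add: algebra_simps)
  then show ?thesis using norm_character[OF assms, of y] by (simp add: norm_mult)
qed

lemma character_eq_iff:
  assumes "character \<phi>"
  shows "\<phi> x = \<phi> y \<longleftrightarrow> \<phi> (x - y) = 1"
  using dist_character[OF assms, of x y] by (metis eq_iff_diff_eq_0 norm_eq_zero)

lemma annihilator_one: "(\<lambda>_. 1) \<in> annihilator N"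
  by (simp add: annihilator_def character_def)

lemma annihilator_mult:
  "\<phi> \<in> annihilator N \<Longrightarrow> \<psi> \<in> annihilator N \<Longrightarrow> (\<lambda>x. \<phi> x * \<psi> x) \<in> annihilator N"
  by (simp add: annihilator_def character_def norm_mult)

lemma annihilator_cnj: "\<phi> \<in> annihilator N \<Longrightarrow> (\<lambda>x. cnj (\<phi> x)) \<in> annihilator N"
  by (simp add: annihilator_def character_def)

lemma annihilator_power: "\<phi> \<in> annihilator N \<Longrightarrow> (\<lambda>x. \<phi> x ^ k) \<in> annihilator N"
  by (simp add: annihilator_def character_def norm_power power_mult_distrib)

lemma annihilator_character: "\<phi> \<in> annihilator N \<Longrightarrow> character \<phi>"
  by (simp add: annihilator_def)

text \<open>This expresses a coset by conditions that are closed in every topology making the characters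
  continuous.\<close>
lemma coset_eq_character_fibres:
  assumes N: "add_subgroup N"
  shows "{y. y - x \<in> N} = (\<Inter>\<phi>\<in>annihilator N. {y. \<phi> y = \<phi> x})"
proof (intro equalityI subsetI)
  fix y assume "y \<in> {y. y - x \<in> N}"
  then have "\<phi> (y - x) = 1" if "\<phi> \<in> annihilator N" for \<phi>
    using that by (simp add: annihilator_def)
  then show "y \<in> (\<Inter>\<phi>\<in>annihilator N. {y. \<phi> y = \<phi> x})"
    using character_eq_iff annihilator_character by blast
next
  fix y assume y: "y \<in> (\<Inter>\<phi>\<in>annihilator N. {y. \<phi> y = \<phi> x})"
  show "y \<in> {y. y - x \<in> N}"
  proof (rule ccontr)
    assume "y \<notin> {y. y - x \<in> N}"
    then obtain \<phi> where "\<phi> \<in> annihilator N" "\<phi> (y - x) \<noteq> 1"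
      using annihilator_separates[OF N, of "y - x"] by blast
    then show False using y character_eq_iff[of \<phi> y x] annihilator_character by blast
  qed
qed

text \<open>The topology on characters is pointwise convergence, so this is Tychonoff's theorem for a
  power of the unit circle.\<close>
lemma compact_annihilator: "compact (annihilator N)"
proof -
  have "annihilator N =
      (\<Inter>x. \<Inter>y. {\<phi>. \<phi> (x + y) = \<phi> x * \<phi> y}) \<inter> (\<Inter>x\<in>N. {\<phi>. \<phi> x = 1}) \<inter> (\<Pi>\<^sub>E x\<in>UNIV. sphere 0 1)"
    by (auto simp: annihilator_def character_def)
  moreover have "closed ((\<Inter>x. \<Inter>y. {\<phi>::'a \<Rightarrow> complex. \<phi> (x + y) = \<phi> x * \<phi> y}) \<inter> (\<Inter>x\<in>N. {\<phi>. \<phi> x = 1}))"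
    by (intro closed_Int closed_INT ballI closed_Collect_eq continuous_on_mult
        continuous_on_const continuous_on_product_coordinates)
  moreover have "compact (\<Pi>\<^sub>E x\<in>(UNIV::'a set). sphere (0::complex) 1)"
    using compactin_PiE[of "\<lambda>_. euclidean" "UNIV :: 'a set" "\<lambda>_. sphere (0::complex) 1"]
    by (simp add: euclidean_product_topology compactin_euclidean_iff)
  ultimately show ?thesis by (simp add: closed_Int_compact)
qed

text \<open>Squaring moves a point near 1 away from 1: since \<open>w\<^sup>2 - 1 = (w + 1) (w - 1)\<close> and \<open>norm (w + 1)
  \<ge> 5/4\<close> when \<open>norm (w - 1) \<le> 3/4\<close>, each squaring multiplies the distance to 1 by at least
  \<open>5/4\<close>.\<close>
lemma unit_power_near_one:
  fixes z :: complex
  assumes "\<And>k. norm (z ^ k - 1) \<le> 3/4"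
  shows "z = 1"
proof (rule ccontr)
  assume "z \<noteq> 1"
  then have pos: "norm (z - 1) > 0" by simp
  have step: "(5/4) ^ j * norm (z - 1) \<le> norm (z ^ (2 ^ j) - 1)" for j
  proof (induction j)
    case (Suc j)
    define w where "w = z ^ (2 ^ j)"
    have "norm (w - 1) \<le> 3/4" using assms by (simp add: w_def)
    moreover have "norm (2::complex) \<le> norm (w + 1) + norm (1 - w)"
      using norm_triangle_ineq[of "w + 1" "1 - w"] by simp
    ultimately have "5/4 \<le> norm (w + 1)" by (simp add: norm_minus_commute)
    then have "(5/4) * norm (w - 1) \<le> norm (w + 1) * norm (w - 1)"
      by (rule mult_right_mono) simp
    also have "\<dots> = norm (w ^ 2 - 1)"
      by (simp add: norm_mult[symmetric] power2_eq_square algebra_simps)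
    also have "w ^ 2 = z ^ (2 ^ Suc j)" by (simp add: w_def power_mult[symmetric] mult.commute)
    finally show ?case using Suc by (simp add: w_def)
  qed simp
  obtain j where "1 / norm (z - 1) < (5/4 :: real) ^ j"
    using real_arch_pow[of "5/4"] by auto
  then have "1 < (5/4) ^ j * norm (z - 1)" using pos by (simp add: divide_less_eq)
  then show False using step[of j] assms[of "2 ^ j"] by linarith
qed

text \<open>The closed sets of characters with error at most \<open>e\<close> from the index \<open>m\<close> on cover the compact
  group, one set for each \<open>m\<close>. By the Baire category theorem one of them has an interior point.\<close>
lemma annihilator_Baire:
  fixes y :: "nat \<Rightarrow> 'a::ab_group_add"
  assumes lim: "\<And>\<phi>. \<phi> \<in> annihilator N \<Longrightarrow> (\<lambda>n. \<phi> (y n)) \<longlonglongrightarrow> 1" and "e > 0"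
  obtains W \<phi>\<^sub>0 and m :: nat where "open W" "\<phi>\<^sub>0 \<in> W" "\<phi>\<^sub>0 \<in> annihilator N"
    "\<And>\<phi> n. \<phi> \<in> annihilator N \<inter> W \<Longrightarrow> n \<ge> m \<Longrightarrow> norm (\<phi> (y n) - 1) \<le> e"
proof -
  let ?A = "annihilator N" and ?X = "top_of_set (annihilator N)"
  define F where "F m = {\<phi> \<in> ?A. \<forall>n\<ge>m. norm (\<phi> (y n) - 1) \<le> e}" for m :: nat
  have "closedin ?X (F m)" for m
  proof -
    have "F m = ?A \<inter> (\<Inter>n\<in>{m..}. {\<phi>. norm (\<phi> (y n) - 1) \<le> e})"
      by (auto simp: F_def)
    moreover have "closed (\<Inter>n\<in>{m..}. {\<phi> :: 'a \<Rightarrow> complex. norm (\<phi> (y n) - 1) \<le> e})"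
      by (intro closed_INT ballI closed_Collect_le continuous_on_norm continuous_on_diff
          continuous_on_const continuous_on_product_coordinates)
    ultimately show ?thesis by (simp add: closedin_closed_Int)
  qed
  moreover have union: "\<Union> (range F) = ?A"
  proof (intro equalityI subsetI)
    fix \<phi> assume \<phi>: "\<phi> \<in> ?A"
    have "\<forall>\<^sub>F n in sequentially. dist (\<phi> (y n)) 1 < e"
      using lim[OF \<phi>] \<open>e > 0\<close> by (rule tendstoD)
    then obtain m where "\<forall>n\<ge>m. dist (\<phi> (y n)) 1 < e"
      by (auto simp: eventually_sequentially)
    then have "\<phi> \<in> F m" using \<phi> by (force simp: F_def dist_norm)
    then show "\<phi> \<in> \<Union> (range F)" by blast
  qed (auto simp: F_def)
  moreover have "compact_space ?X" "Hausdorff_space ?X"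
  proof -
    show "compact_space ?X"
      using compact_annihilator by (metis compact_space_subtopology compactin_euclidean_iff)
    have "Hausdorff_space (product_topology (\<lambda>_::'a. euclidean :: complex topology) UNIV)"
      unfolding Hausdorff_space_product_topology by (simp add: Hausdorff_space_euclidean)
    then show "Hausdorff_space ?X"
      by (simp add: euclidean_product_topology Hausdorff_space_subtopology)
  qed
  moreover have "?X interior_of ?A \<noteq> {}"
    using annihilator_one interior_of_topspace[of ?X] by force
  ultimately have "\<exists>T\<in>range F. ?X interior_of T \<noteq> {}"
    using Baire_category_alt[of ?X "range F"] compact_imp_locally_compact_space[of ?X]
      compact_Hausdorff_imp_regular_space[of ?X] by (metis countable_image countableI_type rangeE)
  then obtain m where "?X interior_of F m \<noteq> {}" by blast
  then obtain \<phi>\<^sub>0 V where V: "openin ?X V" "\<phi>\<^sub>0 \<in> V" "V \<subseteq> F m"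
    by (auto simp: interior_of_def)
  then obtain W where "open W" "V = ?A \<inter> W" by (auto simp: openin_open)
  then show thesis using that[of W \<phi>\<^sub>0 m] V by (auto simp: F_def)
qed

text \<open>This replaces the theorem that the Bohr topology of a discrete group has no nontrivial
  convergent sequences. On some open set of characters the error is uniformly small from one
  index on. Finitely many translates of it cover the compact group, and on the finitely many
  translating characters the sequence converges, so the error becomes uniformly small on the
  whole group. Applied to the powers of a character, this bound forces the character to be
  exactly 1 at late terms of the sequence.\<close>
lemma annihilator_null_sequence_eventually_in:
  fixes y :: "nat \<Rightarrow> 'a::ab_group_add"
  assumes N: "add_subgroup N"
    and lim: "\<And>\<phi>. \<phi> \<in> annihilator N \<Longrightarrow> (\<lambda>n. \<phi> (y n)) \<longlonglongrightarrow> 1"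
  shows "\<forall>\<^sub>F n in sequentially. y n \<in> N"
proof -
  let ?A = "annihilator N"
  \<comment> \<open>Three errors of size \<open>1/4\<close> will add up: at the translated character, at \<open>\<psi>\<close> and at \<open>\<phi>\<^sub>0\<close>.
    Their sum \<open>3/4\<close> is the bound in \<open>unit_power_near_one\<close>.\<close>
  obtain W \<phi>\<^sub>0 m where W: "open W" "\<phi>\<^sub>0 \<in> W" and \<phi>\<^sub>0: "\<phi>\<^sub>0 \<in> ?A"
    and near: "\<And>\<phi> n. \<phi> \<in> ?A \<inter> W \<Longrightarrow> n \<ge> m \<Longrightarrow> norm (\<phi> (y n) - 1) \<le> 1/4"
    using annihilator_Baire[of N y "1/4"] lim by (metis zero_less_divide_1_iff zero_less_numeral)
  \<comment> \<open>The translate of \<open>W\<close> by \<open>\<psi> / \<phi>\<^sub>0\<close>, which contains \<open>\<psi>\<close> because \<open>\<phi>\<^sub>0 \<in> W\<close>.\<close>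
  define tr where "tr \<psi> = (\<lambda>\<phi> x. \<phi> x * cnj (\<psi> x) * \<phi>\<^sub>0 x) -` W" for \<psi>
  have open_tr: "open (tr \<psi>)" for \<psi>
    unfolding tr_def
    by (intro open_vimage W continuous_on_coordinatewise_then_product continuous_on_mult
        continuous_on_const continuous_on_product_coordinates)
  have self: "\<psi> \<in> tr \<psi>" if "\<psi> \<in> ?A" for \<psi>
    using W(2) character_mult_cnj[OF annihilator_character[OF that]] by (simp add: tr_def)
  have "?A \<subseteq> (\<Union>\<psi>\<in>?A. tr \<psi>)" using self by blast
  then obtain C where C: "C \<subseteq> ?A" "finite C" "?A \<subseteq> (\<Union>\<psi>\<in>C. tr \<psi>)"
    using compactE_image[OF compact_annihilator[of N], of ?A tr, OF open_tr] by metis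
  have "\<forall>\<^sub>F n in sequentially. dist (\<psi> (y n)) 1 < 1/4" if "\<psi> \<in> C" for \<psi>
    using lim[of \<psi>] that C(1) by (intro tendstoD) auto
  then have "\<forall>\<^sub>F n in sequentially. \<forall>\<psi>\<in>C. dist (\<psi> (y n)) 1 < 1/4"
    using C(2) by (simp add: eventually_ball_finite_distrib)
  then show ?thesis
    using eventually_ge_at_top[of m]
  proof eventually_elim
    case (elim n)
    have small: "norm (\<phi> (y n) - 1) \<le> 3/4" if \<phi>: "\<phi> \<in> ?A" for \<phi>
    proof -
      obtain \<psi> where \<psi>: "\<psi> \<in> C" "\<phi> \<in> tr \<psi>" using C(3) \<phi> by blast
      define \<eta> where "\<eta> = (\<lambda>x. \<phi> x * cnj (\<psi> x) * \<phi>\<^sub>0 x)"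
      have \<psi>A: "\<psi> \<in> ?A" using \<psi> C by blast
      have "\<eta> \<in> ?A \<inter> W"
        using \<psi>(2) annihilator_mult[OF annihilator_mult[OF \<phi> annihilator_cnj[OF \<psi>A]] \<phi>\<^sub>0]
        by (simp add: \<eta>_def tr_def)
      then have 1: "norm (\<eta> (y n) - 1) \<le> 1/4" using near elim by blast
      have 2: "norm (\<phi>\<^sub>0 (y n) - 1) \<le> 1/4" using near[of \<phi>\<^sub>0 n] \<phi>\<^sub>0 W elim by blast
      have 3: "norm (\<psi> (y n) - 1) \<le> 1/4" using elim \<psi>(1) by (force simp: dist_norm)
      let ?p = "\<phi> (y n)" and ?q = "\<psi> (y n)" and ?r = "\<phi>\<^sub>0 (y n)"
      have q: "?q * cnj ?q = 1" "norm ?q = 1" and r: "norm ?r = 1"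
        using \<psi>A \<phi>\<^sub>0 by (auto intro: character_mult_cnj annihilator_character norm_character)
      have "(?p - 1) * ?r = ?p * (cnj ?q * ?q) * ?r - ?r" using q by (simp add: algebra_simps)
      also have "\<dots> = (\<eta> (y n) - 1) * ?q + (?q - 1) - (?r - 1)"
        by (simp add: \<eta>_def algebra_simps)
      finally have "norm (?p - 1) = norm ((\<eta> (y n) - 1) * ?q + (?q - 1) - (?r - 1))"
        using r by (metis mult.right_neutral norm_mult)
      also have "\<dots> \<le> norm (\<eta> (y n) - 1) + norm (?q - 1) + norm (?r - 1)"
        using norm_triangle_ineq4[of "(\<eta> (y n) - 1) * ?q + (?q - 1)" "?r - 1"]
          norm_triangle_ineq[of "(\<eta> (y n) - 1) * ?q" "?q - 1"] q(2) by (simp add: norm_mult)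
      finally show ?thesis using 1 2 3 by linarith
    qed
    have "\<phi> (y n) = 1" if "\<phi> \<in> ?A" for \<phi>
      using small[OF annihilator_power[OF that]] by (rule unit_power_near_one)
    then show "y n \<in> N" using annihilator_separates[OF N] by blast
  qed
qed

section \<open>Countable compact spaces\<close>

text \<open>Each point \<open>p\<close> is the intersection of the closures of countably many of its neighbourhoods,
  one for each other point. By compactness, finite intersections of these neighbourhoods are
  eventually inside any given neighbourhood of \<open>p\<close>, so they serve as a countable base at \<open>p\<close>.\<close>
lemma countable_compact_closure_imp_limit:
  assumes X: "compact_space X" "Hausdorff_space X" "countable (topspace X)"
    and p: "p \<in> X closure_of S"
  obtains \<sigma> where "range \<sigma> \<subseteq> S" "limitin X \<sigma> p sequentially"
proof -
  have pX: "p \<in> topspace X" using p by (simp add: in_closure_of)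
  have "\<exists>U. openin X U \<and> p \<in> U \<and> (q \<in> topspace X \<and> q \<noteq> p \<longrightarrow> q \<notin> X closure_of U)" for q
  proof (cases "q \<in> topspace X \<and> q \<noteq> p")
    case True
    then obtain U V where "openin X U" "openin X V" "p \<in> U" "q \<in> V" "disjnt U V"
      using X(2) pX unfolding Hausdorff_space_def by metis
    then show ?thesis by (auto simp: in_closure_of disjnt_iff)
  next
    case False
    then show ?thesis using pX openin_topspace by blast
  qed
  then obtain U where U: "\<And>q. openin X (U q)" "\<And>q. p \<in> U q"
    "\<And>q. q \<in> topspace X \<Longrightarrow> q \<noteq> p \<Longrightarrow> q \<notin> X closure_of U q" by metis
  define q where "q = from_nat_into (topspace X)"
  have q: "range q = topspace X"
    unfolding q_def using X(3) pX by (intro range_from_nat_into) auto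
  define V where "V n = (\<Inter>i\<in>{..n}. U (q i))" for n :: nat
  have "openin X (V n)" for n
    unfolding V_def by (intro openin_Inter) (auto simp: U)
  moreover have "p \<in> V n" for n by (simp add: V_def U)
  ultimately have "\<exists>s. s \<in> S \<and> s \<in> V n" for n
    using p unfolding in_closure_of by blast
  then obtain \<sigma> where \<sigma>: "\<And>n. \<sigma> n \<in> S" "\<And>n. \<sigma> n \<in> V n" by metis
  have V_sub: "V n \<subseteq> topspace X" for n
    using openin_subset[OF U(1)] by (fastforce simp: V_def)
  have "\<forall>\<^sub>F n in sequentially. \<sigma> n \<in> W" if W: "openin X W" "p \<in> W" for W
  proof -
    define C where "C n = (\<Inter>i\<in>{..n}. X closure_of U (q i)) - W" for n :: nat
    have "closedin X (C n)" for n
      unfolding C_def by (intro closedin_diff closedin_Inter) (use W in auto)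
    moreover have "decseq C" by (force simp: C_def decseq_def)
    moreover have "(\<Inter>n. C n) = {}"
    proof (rule ccontr)
      assume "(\<Inter>n. C n) \<noteq> {}"
      then obtain z where z: "\<And>n. z \<in> C n" by blast
      have "z \<in> topspace X" using z[of 0] closure_of_subset_topspace by (force simp: C_def)
      then obtain i where "z = q i" using q by blast
      then show False using z[of i] U(3) W \<open>z \<in> topspace X\<close> by (auto simp: C_def)
    qed
    ultimately obtain n where n: "C n = {}"
      using compact_space_imp_nest[OF X(1), of C] by blast
    have "\<sigma> k \<in> W" if "k \<ge> n" for k
    proof -
      have "\<sigma> k \<in> (\<Inter>i\<in>{..n}. X closure_of U (q i))"
        using \<sigma>(2)[of k] that closure_of_subset[OF openin_subset[OF U(1)]]
        by (fastforce simp: V_def)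
      then show ?thesis using n by (auto simp: C_def)
    qed
    then show ?thesis by (auto simp: eventually_sequentially)
  qed
  then have "limitin X \<sigma> p sequentially" using pX by (simp add: limitin_def)
  then show thesis using that \<sigma>(1) by blast
qed

section \<open>Characters that are continuous for the finest topology\<close>

text \<open>The coarsest topology finer than \<open>T\<close> that makes \<open>\<phi>\<close> continuous.\<close>
definition character_refinement :: "'a topology \<Rightarrow> ('a \<Rightarrow> complex) \<Rightarrow> 'a::ab_group_add topology" where
  "character_refinement T \<phi> = pullback_topology UNIV (\<lambda>x. (x, \<phi> x)) (prod_topology T euclidean)"

lemma continuous_map_character_refinement_id:
  "topspace T = UNIV \<Longrightarrow> continuous_map (character_refinement T \<phi>) T (\<lambda>x. x)"
  unfolding character_refinement_def
  using continuous_map_pullback[OF continuous_map_fst, of UNIV "\<lambda>x. (x, \<phi> x)" T euclidean] 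
  by (simp add: o_def)

lemma continuous_map_character_refinement_character:
  "continuous_map (character_refinement T \<phi>) euclidean \<phi>"
  unfolding character_refinement_def
  using continuous_map_pullback[OF continuous_map_snd, of UNIV "\<lambda>x. (x, \<phi> x)" T euclidean] 
  by (simp add: o_def)

lemma continuous_map_into_character_refinement:
  assumes "continuous_map X T f" "continuous_map X euclidean (\<lambda>x. \<phi> (f x))"
  shows "continuous_map X (character_refinement T \<phi>) f"
  unfolding character_refinement_def
  using assms by (intro continuous_map_pullback') (auto simp: o_def intro: continuous_map_pairedI)

lemma continuous_map_euclidean_compose:
  assumes "continuous_map X euclidean f" "continuous_on UNIV g"
  shows "continuous_map X euclidean (\<lambda>x. g (f x))"
  using continuous_map_compose[OF assms(1), of euclidean g] assms(2) by (simp add: o_def)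

lemma group_topology_character_refinement:
  assumes T: "group_topology T" and \<phi>: "character \<phi>"
  shows "group_topology (character_refinement T \<phi>)"
proof -
  let ?S = "character_refinement T \<phi>"
  have top: "topspace T = UNIV" and plus: "continuous_map (prod_topology T T) T (\<lambda>(x, y). x + y)"
    and um: "continuous_map T T uminus" using T by (auto simp: group_topology_def)
  have id: "continuous_map ?S T (\<lambda>x. x)" by (rule continuous_map_character_refinement_id[OF top])
  have ch: "continuous_map ?S euclidean \<phi>" by (rule continuous_map_character_refinement_character)
  have fst: "continuous_map (prod_topology ?S ?S) ?S fst" and snd: "continuous_map (prod_topology ?S ?S) ?S snd"
    by (rule continuous_map_fst continuous_map_snd)+
  have "continuous_map (prod_topology ?S ?S) (prod_topology T T) (\<lambda>p. (fst p, snd p))"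
    using continuous_map_compose[OF fst id] continuous_map_compose[OF snd id]
    by (intro continuous_map_pairedI) (simp_all add: o_def)
  from continuous_map_compose[OF this plus]
  have 1: "continuous_map (prod_topology ?S ?S) T (\<lambda>(x, y). x + y)"
    by (simp add: o_def case_prod_unfold)
  have "continuous_map (prod_topology ?S ?S) (prod_topology euclidean euclidean) (\<lambda>p. (\<phi> (fst p), \<phi> (snd p)))"
    using continuous_map_compose[OF fst ch] continuous_map_compose[OF snd ch]
    by (intro continuous_map_pairedI) (simp_all add: o_def)
  then have "continuous_map (prod_topology ?S ?S) euclidean (\<lambda>p. (\<phi> (fst p), \<phi> (snd p)))" by simp
  from continuous_map_euclidean_compose[OF this, of "\<lambda>z. fst z * snd z"]
  have 2: "continuous_map (prod_topology ?S ?S) euclidean (\<lambda>p. \<phi> (case p of (x, y) \<Rightarrow> x + y))"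
    by (simp add: case_prod_beta character_add[OF \<phi>] continuous_on_mult continuous_on_fst continuous_on_snd continuous_on_id)
  have 3: "continuous_map ?S T uminus"
    using continuous_map_compose[OF id um] by (simp add: o_def)
  have 4: "continuous_map ?S euclidean (\<lambda>x. \<phi> (- x))"
    using continuous_map_euclidean_compose[OF ch, of cnj]
    by (simp add: character_minus[OF \<phi>] continuous_on_cnj continuous_on_id)
  show ?thesis
    unfolding group_topology_def
    using continuous_map_into_character_refinement[OF 1 2] continuous_map_into_character_refinement[OF 3 4] top
    by (simp add: character_refinement_def topspace_pullback_topology)
qed

lemma group_topology_diff_neighbourhood:
  assumes T: "group_topology T" and A: "openin T A" "0 \<in> A"
  obtains V where "openin T V" "0 \<in> V" "\<And>x y. x \<in> V \<Longrightarrow> y \<in> V \<Longrightarrow> x - y \<in> A"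
proof -
  have top: "topspace T = UNIV" and plus: "continuous_map (prod_topology T T) T (\<lambda>(x, y). x + y)"
    and um: "continuous_map T T uminus" using T by (auto simp: group_topology_def)
  define D where "D = {p. (case p of (x, y) \<Rightarrow> x + y) \<in> A}"
  have "openin (prod_topology T T) D"
    using openin_continuous_map_preimage[OF plus A(1)] top by (simp add: D_def)
  moreover have "(0, 0) \<in> D" using A(2) by (simp add: D_def)
  ultimately obtain P Q where PQ: "openin T P" "openin T Q" "0 \<in> P" "0 \<in> Q" and sub: "P \<times> Q \<subseteq> D"
    using openin_prod_topology_alt[THEN iffD1, rule_format] by metis
  have Q': "openin T {x. - x \<in> Q}"
    using openin_continuous_map_preimage[OF um PQ(2)] top by simp
  show thesis
  proof (rule that)
    show "openin T (P \<inter> {x. - x \<in> Q})" using PQ Q' by blast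
    show "x - y \<in> A" if "x \<in> P \<inter> {x. - x \<in> Q}" "y \<in> P \<inter> {x. - x \<in> Q}" for x y
      using that sub by (force simp: D_def)
  qed (use PQ in auto)
qed

text \<open>The refined group embeds into the product of a precompact group with the circle, and total
  boundedness passes to subgroups: one point is chosen in each nonempty cell of a finite cover
  of the product by small cells, and differences of two points in one cell are small.\<close>
lemma precompact_character_refinement:
  assumes T: "precompact_group_topology T" and \<phi>: "character \<phi>"
  shows "precompact_group_topology (character_refinement T \<phi>)"
proof -
  let ?S = "character_refinement T \<phi>"
  have grp: "group_topology T" and haus: "Hausdorff_space T"
    and fin: "\<And>V. openin T V \<Longrightarrow> 0 \<in> V \<Longrightarrow> \<exists>F. finite F \<and> {f + x | f x. f \<in> F \<and> x \<in> V} = UNIV"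
    using T unfolding precompact_group_topology_def by auto
  have top: "topspace T = UNIV" using grp by (simp add: group_topology_def)
  have finer: "openin ?S U" if "openin T U" for U
    using openin_continuous_map_preimage[OF continuous_map_character_refinement_id[OF top] that]
    by (simp add: character_refinement_def topspace_pullback_topology top)
  have "Hausdorff_space ?S"
    using haus finer unfolding Hausdorff_space_def top
    by (simp add: character_refinement_def topspace_pullback_topology top) meson
  moreover have "\<exists>F. finite F \<and> {f + x | f x. f \<in> F \<and> x \<in> U} = UNIV"
    if V: "openin ?S V" "0 \<in> V" "V \<subseteq> U" for U V
  proof -
    obtain W where W: "openin (prod_topology T euclidean) W" "V = (\<lambda>x. (x, \<phi> x)) -` W"
      using V(1) by (auto simp: character_refinement_def openin_pullback_topology)
    have "(0, 1) \<in> W" using V(2) W(2) character_zero[OF \<phi>] by simp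
    then obtain A B where AB: "openin T A" "open B" "0 \<in> A" "1 \<in> B" "A \<times> B \<subseteq> W"
      using openin_prod_topology_alt[THEN iffD1, rule_format, OF W(1)] open_openin by metis
    obtain e where e: "e > 0" "ball 1 e \<subseteq> B" using AB by (meson openE)
    obtain V\<^sub>0 where V\<^sub>0: "openin T V\<^sub>0" "0 \<in> V\<^sub>0" "\<And>x y. x \<in> V\<^sub>0 \<Longrightarrow> y \<in> V\<^sub>0 \<Longrightarrow> x - y \<in> A"
      using group_topology_diff_neighbourhood[OF grp AB(1,3)] by blast
    obtain F\<^sub>1 where F\<^sub>1: "finite F\<^sub>1" "{f + x | f x. f \<in> F\<^sub>1 \<and> x \<in> V\<^sub>0} = UNIV"
      using fin[OF V\<^sub>0(1,2)] by blast
    obtain C where C: "finite C" "sphere (0::complex) 1 \<subseteq> (\<Union>c\<in>C. ball c (e/2))"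
      using compactE_image[OF compact_sphere[of "0::complex" 1], of "sphere 0 1" "\<lambda>c. ball c (e/2)"] e(1)
      by (metis UN_I centre_in_ball half_gt_zero open_ball subsetI)
    define P where "P f c x \<longleftrightarrow> x - f \<in> V\<^sub>0 \<and> \<phi> x \<in> ball c (e/2)" for f c x
    \<comment> \<open>For an empty cell the choice yields some arbitrary point, which does no harm.\<close>
    define F where "F = (\<lambda>(f, c). SOME x. P f c x) ` (F\<^sub>1 \<times> C)"
    have "\<exists>f\<in>F. x - f \<in> U" for x
    proof -
      obtain f v where f: "f \<in> F\<^sub>1" "v \<in> V\<^sub>0" "x = f + v" using F\<^sub>1(2) by blast
      have "\<phi> x \<in> sphere 0 1" using \<phi> by simp
      then obtain c where c: "c \<in> C" "\<phi> x \<in> ball c (e/2)" using C(2) by blast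
      have P: "P f c x" using f c by (simp add: P_def)
      define x\<^sub>0 where "x\<^sub>0 = (SOME x. P f c x)"
      have P0: "P f c x\<^sub>0" unfolding x\<^sub>0_def using P by (rule someI)
      have "x - x\<^sub>0 \<in> A" using V\<^sub>0(3)[of "x - f" "x\<^sub>0 - f"] P P0 by (simp add: P_def)
      moreover have "dist (\<phi> x) (\<phi> x\<^sub>0) < e"
        using P P0 dist_triangle_half_r[of c "\<phi> x" e "\<phi> x\<^sub>0"] by (simp add: P_def)
      then have "\<phi> (x - x\<^sub>0) \<in> ball 1 e"
        using dist_character[OF \<phi>, of x x\<^sub>0] by (simp add: dist_norm norm_minus_commute)
      ultimately have "x - x\<^sub>0 \<in> U" using AB(5) e(2) W(2) V(3) by blast
      moreover have "x\<^sub>0 \<in> F" using f c by (auto simp: F_def x\<^sub>0_def)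
      ultimately show ?thesis by blast
    qed
    then have "\<exists>f x. y = f + x \<and> f \<in> F \<and> x \<in> U" for y
      by (metis add.commute diff_add_cancel)
    then have "{f + x | f x. f \<in> F \<and> x \<in> U} = UNIV" by auto
    moreover have "finite F" using F\<^sub>1 C by (simp add: F_def)
    ultimately show ?thesis by blast
  qed
  ultimately show ?thesis
    using group_topology_character_refinement[OF grp \<phi>]
    unfolding precompact_group_topology_def by blast
qed

lemma is_tau_character_continuous:
  assumes T: "is_tau u T" and \<phi>: "\<phi> \<in> annihilator (range u)"
  shows "continuous_map T euclidean \<phi>"
proof -
  let ?S = "character_refinement T \<phi>"
  have pc: "precompact_group_topology T" and lim: "limitin T u 0 sequentially"
    using T by (auto simp: is_tau_def)
  have top: "topspace T = UNIV" using pc by (simp add: precompact_group_topology_def group_topology_def)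
  have ch: "character \<phi>" and one: "\<And>n. \<phi> (u n) = 1" using \<phi> by (auto simp: annihilator_def)
  have "limitin ?S u 0 sequentially"
    unfolding limitin_def
  proof (intro conjI allI impI)
    show "0 \<in> topspace ?S" by (simp add: character_refinement_def topspace_pullback_topology top)
    fix U assume U: "openin ?S U \<and> 0 \<in> U"
    then obtain W where W: "openin (prod_topology T euclidean) W" "U = (\<lambda>x. (x, \<phi> x)) -` W"
      by (auto simp: character_refinement_def openin_pullback_topology)
    have "limitin (prod_topology T euclidean) (\<lambda>n. (u n, 1::complex)) (0, 1) sequentially"
      using lim by (simp add: limitin_pairwise o_def)
    moreover have "(0, 1) \<in> W" using U W(2) character_zero[OF ch] by auto
    ultimately show "\<forall>\<^sub>F n in sequentially. u n \<in> U"
      using W by (simp add: limitin_def one)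
  qed
  then have "openin T U" if "openin ?S U" for U
    using T that precompact_character_refinement[OF pc ch] unfolding is_tau_def by blast
  moreover have "topspace ?S = UNIV" by (simp add: character_refinement_def topspace_pullback_topology top)
  ultimately show ?thesis
    using continuous_map_character_refinement_character[of T \<phi>] top
    by (simp add: continuous_map_def)
qed

section \<open>Compact sets meet finitely many cosets\<close>

lemma is_tau_closed_coset:
  assumes T: "is_tau u T" and M: "add_subgroup M" "range u \<subseteq> M"
  shows "closedin T {y. y - x \<in> M}"
proof -
  have "topspace T = UNIV"
    using T by (simp add: is_tau_def precompact_group_topology_def group_topology_def)
  moreover have "continuous_map T euclidean \<phi>" if "\<phi> \<in> annihilator M" for \<phi>
    using is_tau_character_continuous[OF T] that M(2) by (auto simp: annihilator_def)
  ultimately have "closedin T {y. \<phi> y = \<phi> x}" if "\<phi> \<in> annihilator M" for \<phi>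
    using closedin_continuous_map_preimage[of T euclidean \<phi> "{\<phi> x}"] that by simp
  then show ?thesis
    unfolding coset_eq_character_fibres[OF M(1)]
    using annihilator_one by (intro closedin_Inter) auto
qed

lemma is_tau_limit_eventually_in_coset:
  assumes T: "is_tau u T" and N: "add_subgroup N" "range u \<subseteq> N"
    and lim: "limitin T \<sigma> p sequentially"
  shows "\<forall>\<^sub>F n in sequentially. \<sigma> n - p \<in> N"
proof (rule annihilator_null_sequence_eventually_in[OF N(1)])
  fix \<phi> assume \<phi>: "\<phi> \<in> annihilator N"
  then have ch: "character \<phi>" by (rule annihilator_character)
  have "continuous_map T euclidean \<phi>"
    using is_tau_character_continuous[OF T] \<phi> N(2) by (auto simp: annihilator_def)
  from continuous_map_limit[OF this lim]
  have "(\<lambda>n. \<phi> (\<sigma> n)) \<longlonglongrightarrow> \<phi> p" by (simp add: limitin_canonical_iff o_def)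
  then have "(\<lambda>n. \<phi> (\<sigma> n) * cnj (\<phi> p)) \<longlonglongrightarrow> \<phi> p * cnj (\<phi> p)"
    by (intro tendsto_mult tendsto_const)
  then show "(\<lambda>n. \<phi> (\<sigma> n - p)) \<longlonglongrightarrow> 1"
    by (simp add: character_diff[OF ch] character_mult_cnj[OF ch])
qed

text \<open>Otherwise there is a countably infinite set \<open>S\<close> of points of \<open>K\<close> in distinct cosets of \<open>N\<close>. The subgroup \<open>M\<close>
  generated by \<open>N\<close> and \<open>S\<close> is countable, and closed because it contains \<open>N\<close>. Thus \<open>M \<inter> K\<close> is a
  countable compact space in which \<open>S\<close> accumulates at some \<open>p\<close>. At most one point of \<open>S\<close> lies in
  the coset of \<open>p\<close>; without it, \<open>p\<close> is still the limit of a sequence in \<open>S\<close>, which contradicts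
  \<open>is_tau_limit_eventually_in_coset\<close>.\<close>
lemma is_tau_compact_finite_cosets:
  assumes T: "is_tau u T" and K: "compactin T K"
  shows "finite ((\<lambda>x. {y. y - x \<in> group_closure (range u)}) ` K)"
proof (rule ccontr)
  let ?N = "group_closure (range u)"
  let ?coset = "\<lambda>x. {y. y - x \<in> ?N}"
  assume "infinite (?coset ` K)"
  then obtain B where B: "countable B" "infinite B" "B \<subseteq> ?coset ` K"
    using infinite_countable_subset' by metis
  then obtain S where S: "S \<subseteq> K" "inj_on ?coset S" "B = ?coset ` S"
    by (auto simp: subset_image_inj)
  have infS: "infinite S" and cS: "countable S"
    using B S by (auto dest: countable_image_inj_on)
  have haus: "Hausdorff_space T" and top: "topspace T = UNIV"
    using T by (simp_all add: is_tau_def precompact_group_topology_def group_topology_def)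
  have N: "add_subgroup ?N" "range u \<subseteq> ?N"
    by (auto intro: add_subgroup_group_closure group_closure.base)
  define M where "M = group_closure (range u \<union> S)"
  have M: "add_subgroup M" "range u \<subseteq> M" "S \<subseteq> M" "countable M"
    using cS by (auto simp: M_def intro: add_subgroup_group_closure group_closure.base countable_group_closure)
  have "closedin T M" using is_tau_closed_coset[OF T M(1,2), of 0] by simp
  then have "compactin T (M \<inter> K)" using K by (rule closed_Int_compactin)
  then have X: "compact_space (subtopology T (M \<inter> K))" (is "compact_space ?X")
    by (rule compact_space_subtopology)
  have topX: "topspace ?X = M \<inter> K" by (simp add: top)
  have hausX: "Hausdorff_space ?X" using haus by (rule Hausdorff_space_subtopology)
  have cX: "countable (topspace ?X)" using M(4) by (simp add: topX)
  have "?X derived_set_of S \<noteq> {}"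
    using compact_space_imp_Bolzano_Weierstrass[OF X infS] S(1) M(3) by (simp add: top)
  then obtain p where p: "p \<in> ?X derived_set_of S" by blast
  define E where "E = {x \<in> S. x - p \<in> ?N}"
  have "x = y" if "x \<in> E" "y \<in> E" for x y
  proof -
    have xy: "x - y \<in> ?N" using add_subgroup_diff[OF N(1), of "x - p" "y - p"] that by (simp add: E_def)
    have "z - x \<in> ?N \<longleftrightarrow> z - y \<in> ?N" for z
      using add_subgroup_add[OF N(1) _ xy, of "z - x"] add_subgroup_diff[OF N(1) _ xy, of "z - y"] by auto
    then have "?coset x = ?coset y" by simp
    then show ?thesis using S(2) that by (auto simp: E_def inj_on_def)
  qed
  then have "E \<subseteq> {x}" if "x \<in> E" for x using that by blast
  then have "finite E" by (metis finite.emptyI finite_insert finite_subset ex_in_conv)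
  then have "?X derived_set_of E = {}"
    using hausX by (simp add: derived_set_of_finite)
  moreover have "S = (S - E) \<union> E" by (auto simp: E_def)
  ultimately have "p \<in> ?X derived_set_of (S - E)"
    using p by (metis derived_set_of_Un sup_bot.right_neutral)
  then have "p \<in> ?X closure_of (S - E)"
    by (auto simp: closure_of_alt)
  moreover have "S - E \<subseteq> topspace ?X" using S M topX by auto
  ultimately obtain \<sigma> where \<sigma>: "range \<sigma> \<subseteq> S - E" "limitin ?X \<sigma> p sequentially"
    using countable_compact_closure_imp_limit[OF X hausX cX] by metis
  then have "limitin T \<sigma> p sequentially" by (simp add: limitin_subtopology)
  then have "\<forall>\<^sub>F n in sequentially. \<sigma> n - p \<in> ?N"
    by (rule is_tau_limit_eventually_in_coset[OF T N])
  then obtain n where "\<sigma> n - p \<in> ?N" by (auto simp: eventually_sequentially)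
  then show False using \<sigma>(1) by (auto simp: E_def)
qed

section \<open>Countability and sequentiality\<close>

lemma is_tau_k_space_countable:
  fixes T :: "'a::ab_group_add topology"
  assumes T: "is_tau u T" and k: "k_space T"
  shows "countable (UNIV :: 'a set)"
proof -
  let ?N = "group_closure (range u)"
  let ?coset = "\<lambda>x. {y. y - x \<in> ?N}"
  have top: "topspace T = UNIV"
    using T by (simp add: is_tau_def precompact_group_topology_def group_topology_def)
  have N: "add_subgroup ?N" "range u \<subseteq> ?N"
    by (auto intro: add_subgroup_group_closure group_closure.base)
  have closed_coset: "closedin T (?coset x)" for x by (rule is_tau_closed_coset[OF T N])
  have "closedin (subtopology T K) (K \<inter> - ?N)" if K: "compactin T K" for K
  proof -
    let ?\<C> = "?coset ` (K - ?N)"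
    have "finite ?\<C>"
      using is_tau_compact_finite_cosets[OF T K] by (rule finite_subset[rotated]) auto
    then have "closedin T (\<Union>?\<C>)" using closed_coset by (intro closedin_Union) auto
    moreover have "K \<inter> - ?N = K \<inter> \<Union>?\<C>"
    proof (intro equalityI subsetI)
      fix z assume z: "z \<in> K \<inter> - ?N"
      then have "z \<in> ?coset z" by simp
      then show "z \<in> K \<inter> \<Union>?\<C>" using z by blast
    next
      fix z assume "z \<in> K \<inter> \<Union>?\<C>"
      then obtain x where "z \<in> K" "x \<notin> ?N" "z - x \<in> ?N" by blast
      then show "z \<in> K \<inter> - ?N"
        using add_subgroup_diff[OF N(1), of z "z - x"] by auto
    qed
    ultimately show ?thesis by (auto simp: closedin_subtopology)
  qed
  then have "closedin T (- ?N)" using k top unfolding k_space_def by auto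
  then have open_N: "openin T ?N" by (simp add: closedin_def top Compl_eq_Diff_UNIV[symmetric])
  have precompact: "\<exists>F. finite F \<and> {f + x | f x. f \<in> F \<and> x \<in> V} = UNIV"
    if "openin T V" "0 \<in> V" for V
    using T that unfolding is_tau_def precompact_group_topology_def by blast
  obtain F where F: "finite F" "{f + x | f x. f \<in> F \<and> x \<in> ?N} = UNIV"
    using precompact[OF open_N zero_in_group_closure] by blast
  have "countable ((\<lambda>(f, x). f + x) ` (F \<times> ?N))"
    using F(1) by (intro countable_image countable_SIGMA countable_group_closure) (auto intro: countable_finite)
  moreover have "UNIV \<subseteq> (\<lambda>(f, x). f + x) ` (F \<times> ?N)" unfolding F(2)[symmetric] by auto
  ultimately show ?thesis by (rule countable_subset[rotated])
qed

text \<open>The compact subspaces are countable, so in each of them a sequentially closed set has closed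
  trace.\<close>
lemma countable_k_space_imp_sequential:
  assumes c: "countable (topspace X)" and haus: "Hausdorff_space X" and k: "k_space X"
  shows "sequential_space X"
  unfolding sequential_space_def
proof (intro allI impI)
  fix A assume A: "sequentially_closedin X A"
  then have AX: "A \<subseteq> topspace X" by (simp add: sequentially_closedin_def)
  have "closedin (subtopology X K) (K \<inter> A)" if K: "compactin X K" for K
  proof -
    let ?Y = "subtopology X K"
    have KX: "K \<subseteq> topspace X" using K by (rule compactin_subset_topspace)
    then have topY: "topspace ?Y = K" by auto
    have "?Y closure_of (K \<inter> A) \<subseteq> K \<inter> A"
    proof
      fix p assume p: "p \<in> ?Y closure_of (K \<inter> A)"
      have "countable (topspace ?Y)" using c KX countable_subset topY by metis
      then obtain \<sigma> where \<sigma>: "range \<sigma> \<subseteq> K \<inter> A" "limitin ?Y \<sigma> p sequentially"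
        using countable_compact_closure_imp_limit[OF compact_space_subtopology[OF K]
            Hausdorff_space_subtopology[OF haus] _ p] by metis
      then have "p \<in> K" "limitin X \<sigma> p sequentially" by (auto simp: limitin_subtopology)
      then show "p \<in> K \<inter> A" using A \<sigma>(1) by (auto simp: sequentially_closedin_def)
    qed
    then show ?thesis using topY by (simp add: closure_of_subset_eq[symmetric])
  qed
  then show "closedin X A" using k AX unfolding k_space_def by blast
qed

theorem corollaryC2:
  fixes T :: "'a::ab_group_add topology"
  assumes "precompact_group_topology T"
    and "ss_characterized T"
    and "k_space T"
  shows "countable (UNIV :: 'a set) \<and> sequential_space T"
proof -
  obtain u where "is_tau u T" using assms(2) by (auto simp: ss_characterized_def)
  then have "countable (UNIV :: 'a set)" using assms(3) by (rule is_tau_k_space_countable)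
  moreover have "Hausdorff_space T" "topspace T = UNIV"
    using assms(1) by (simp_all add: precompact_group_topology_def group_topology_def)
  ultimately show ?thesis using countable_k_space_imp_sequential[of T] assms(3) by simp
qed

end
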